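(* For each integer $k\ge0$ there is a pair of conjugate simple $\Gamma$-valued braid monodromy factorizations $\bar{\mathfrak m}'=(\mathfrak m'_i)$, $\bar{\mathfrak m}''=(\mathfrak m''_i)$ of length $k+2$ (i.e. $\mathfrak m''_i=g^{-1}\mathfrak m'_ig$ for all $i$ and some $g\in\Gamma$) that share the same monodromy at infinity $(\mathbb X\mathbb Y)^{-5k-4}$ but are not strongly equivalent.
   Context: $\Gamma=PSL(2,\mathbb Z)$; $\mathbb X,\mathbb Y\in\Gamma$ are the images of the matrices $\begin{pmatrix}-1&1\\-1&0\end{pmatrix}$ and $\begin{pmatrix}0&-1\\1&0\end{pmatrix}$. A $\Gamma$-valued braid monodromy factorization of length $r$ is a sequence $\bar{\mathfrak m}=(\mathfrak m_1,\dots,\mathfrak m_r)$ of elements of $\Gamma$; it is simple if each $\mathfrak m_i$ is conjugate to $\mathbb X\mathbb Y$ in $\Gamma$. Its monodromy at infinity is the product $\mathfrak m_r\cdots\mathfrak m_1$. Two factorizations are strongly (Hurwitz) equivalent if they are related by a finite sequence of Hurwitz moves $(\dots,\mathfrak m_i,\mathfrak m_{i+1},\dots)\mapsto(\dots,\mathfrak m_i^{-1}\mathfrak m_{i+1}\mathfrak m_i,\mathfrak m_i,\dots)$ and their inverses. *)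

theory Defs
  imports "HOL-Analysis.Determinants" "HOL-Algebra.Coset"
begin

definition SL2Z :: "(int^2^2) monoid" where
  "SL2Z = \<lparr>carrier = {A. det A = 1}, mult = (**), one = mat 1\<rparr>"

definition PSL2Z :: "(int^2^2) set monoid" (\<open>\<Gamma>\<close>) where
  "\<Gamma> = SL2Z Mod {mat 1, - mat 1}"

definition PSL2Z_class :: "int^2^2 \<Rightarrow> (int^2^2) set" where
  "PSL2Z_class A = {mat 1, - mat 1} #>\<^bsub>SL2Z\<^esub> A"

definition XX :: "(int^2^2) set" (\<open>\<X>\<close>) where
  "\<X> = PSL2Z_class (vector [vector [-1, 1], vector [-1, 0]])"

definition YY :: "(int^2^2) set" (\<open>\<Y>\<close>) where
  "\<Y> = PSL2Z_class (vector [vector [0, -1], vector [1, 0]])"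

definition conjugate_elements :: "('a, 'b) monoid_scheme \<Rightarrow> 'a \<Rightarrow> 'a \<Rightarrow> bool" where
  "conjugate_elements G a b \<longleftrightarrow>
     a \<in> carrier G \<and> b \<in> carrier G \<and> (\<exists>g \<in> carrier G. b = inv\<^bsub>G\<^esub> g \<otimes>\<^bsub>G\<^esub> a \<otimes>\<^bsub>G\<^esub> g)"

definition bm_factorization :: "('a, 'b) monoid_scheme \<Rightarrow> 'a list \<Rightarrow> bool" where
  "bm_factorization G ms \<longleftrightarrow> set ms \<subseteq> carrier G"

definition simple_factorization :: "(int^2^2) set list \<Rightarrow> bool" where
  "simple_factorization ms \<longleftrightarrow>
     bm_factorization \<Gamma> ms \<and> (\<forall>m \<in> set ms. conjugate_elements \<Gamma> (\<X> \<otimes>\<^bsub>\<Gamma>\<^esub> \<Y>) m)"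

definition conjugate_factorizations ::
  "('a, 'b) monoid_scheme \<Rightarrow> 'a list \<Rightarrow> 'a list \<Rightarrow> bool" where
  "conjugate_factorizations G ms ns \<longleftrightarrow>
     bm_factorization G ms \<and>
     (\<exists>g \<in> carrier G. ns = map (\<lambda>m. inv\<^bsub>G\<^esub> g \<otimes>\<^bsub>G\<^esub> m \<otimes>\<^bsub>G\<^esub> g) ms)"

text \<open>The factors are multiplied in reverse order: \<open>[m\<^sub>1, \<dots>, m\<^sub>r]\<close> is sent to \<open>m\<^sub>r \<cdots> m\<^sub>1\<close>.\<close>

definition monodromy_at_infinity :: "('a, 'b) monoid_scheme \<Rightarrow> 'a list \<Rightarrow> 'a" where
  "monodromy_at_infinity G ms = foldr (\<otimes>\<^bsub>G\<^esub>) (rev ms) \<one>\<^bsub>G\<^esub>"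

text \<open>The membership premise is needed for the inverse moves: for \<open>G = \<Gamma>\<close>,
  \<open>inv x \<otimes> y \<otimes> x\<close> may be a coset although \<open>y\<close> is not one.\<close>

inductive hurwitz_move :: "('a, 'b) monoid_scheme \<Rightarrow> 'a list \<Rightarrow> 'a list \<Rightarrow> bool"
  for G (structure) where
  "bm_factorization G (us @ x # y # vs) \<Longrightarrow>
     hurwitz_move G (us @ x # y # vs) (us @ (inv x \<otimes> y \<otimes> x) # x # vs)"

definition strongly_equivalent :: "('a, 'b) monoid_scheme \<Rightarrow> 'a list \<Rightarrow> 'a list \<Rightarrow> bool" where
  "strongly_equivalent G = equivclp (hurwitz_move G)"

lemma group_SL2Z: "group SL2Z"
proof (rule groupI)
  fix A assume "A \<in> carrier SL2Z"
  then have d: "det A = 1" by (simp add: SL2Z_def)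
  define B :: "int^2^2" where "B = vector [vector [A$2$2, - A$1$2], vector [- A$2$1, A$1$1]]"
  have "det B = 1" using d by (simp add: det_2 B_def mult.commute)
  moreover have "B ** A = mat 1"
    using d by (simp add: B_def det_2 vec_eq_iff forall_2 matrix_matrix_mult_def sum_2 mat_def mult.commute)
  ultimately show "\<exists>B \<in> carrier SL2Z. B \<otimes>\<^bsub>SL2Z\<^esub> A = \<one>\<^bsub>SL2Z\<^esub>"
    by (auto simp: SL2Z_def)
qed (auto simp: SL2Z_def det_mul matrix_mul_assoc)

lemma normal_pm_one: "{mat 1, - mat 1} \<lhd> SL2Z"
proof -
  interpret group SL2Z by (rule group_SL2Z)
  have neg: "(- mat 1) ** A = - A" "A ** (- mat 1) = - A" for A :: "int^2^2"
    by (simp_all add: vec_eq_iff forall_2 matrix_matrix_mult_def sum_2 mat_def)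
  have c: "mat 1 \<in> carrier SL2Z" "- mat 1 \<in> carrier SL2Z"
    by (simp_all add: SL2Z_def det_2 mat_def)
  have m: "(- mat 1) \<otimes>\<^bsub>SL2Z\<^esub> (- mat 1) = \<one>\<^bsub>SL2Z\<^esub>" "mat 1 = \<one>\<^bsub>SL2Z\<^esub>"
    by (simp_all add: SL2Z_def neg)
  have i: "inv\<^bsub>SL2Z\<^esub> (- mat 1) = - mat 1" "inv\<^bsub>SL2Z\<^esub> (mat 1) = mat 1"
    using inv_equality[OF m(1) c(2) c(2)] m(2) by simp_all
  have "subgroup {mat 1, - mat 1} SL2Z"
    by (rule subgroupI) (use c i in \<open>auto simp: SL2Z_def neg\<close>)
  then show ?thesis
    by (rule normalI) (auto simp: r_coset_def l_coset_def SL2Z_def neg)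
qed

lemma group_PSL2Z: "group \<Gamma>"
  unfolding PSL2Z_def by (rule normal.factorgroup_is_group[OF normal_pm_one])

lemma PSL2Z_class_in_carrier: "det A = 1 \<Longrightarrow> PSL2Z_class A \<in> carrier \<Gamma>"
  by (auto simp: PSL2Z_class_def PSL2Z_def FactGroup_def RCOSETS_def SL2Z_def)

lemma XX_carrier: "\<X> \<in> carrier \<Gamma>" and YY_carrier: "\<Y> \<in> carrier \<Gamma>"
  by (auto simp: XX_def YY_def det_2 intro!: PSL2Z_class_in_carrier)

end

theory Submission imports Defs "HOL-Algebra.Generated_Groups" begin

text \<open>
  Write \<open>T = \<X> \<Y>\<close>, the translation \<open>z \<mapsto> z + 1\<close>. If the monodromy at infinity of a factorization is a
  power of \<open>T\<close>, then conjugating all factors by \<open>T\<close> does not change it. A Hurwitz move does not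
  change the subgroup generated by the factors (\<open>strongly_equivalent_in_subgroup\<close>). So it is enough
  to find \<open>r = k + 2\<close> conjugates of \<open>T\<close> with product \<open>T\<close> to the power \<open>- 5 k - 4\<close> such that one of
  their \<open>T\<close>-conjugates lies outside the subgroup \<open>H\<close> that they generate.

  Such factors come from an ideal polygon with Farey vertices. A point \<open>p/q\<close> of the projective line
  is given by the vector \<open>(p, q)\<close> up to sign. Take \<open>x\<^sub>0 = \<infinity>\<close>, \<open>x\<^sub>i = - i\<close> for \<open>0 < i < r\<close> and
  \<open>x\<^sub>r = \<infinity>\<close>, let \<open>v\<^sub>i\<close> be the Farey mediant of \<open>x\<^sub>i\<close> and \<open>x\<^sub>i\<^sub>+\<^sub>1\<close>, and let \<open>t\<^sub>i\<close> be the
  transvection along \<open>v\<^sub>i\<close>. It is conjugate to \<open>T\<close> and sends \<open>x\<^sub>i\<close> to \<open>x\<^sub>i\<^sub>+\<^sub>1\<close>. Hence the product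
  of all \<open>t\<^sub>i\<close> fixes \<open>\<infinity>\<close>, so it is a power of \<open>T\<close>; a closed formula for the partial products
  gives the exponent (\<open>fan_monodromy\<close>).

  The transvection \<open>t\<^sub>i\<close> carries everything off the open arc from \<open>x\<^sub>i\<close> to \<open>v\<^sub>i\<close> into the closed arc
  from \<open>v\<^sub>i\<close> to \<open>x\<^sub>i\<^sub>+\<^sub>1\<close>, and its inverse does the reverse. These \<open>2 r\<close> arcs overlap in end points
  only, so ping-pong shows that every nontrivial element of \<open>H\<close> moves all vertices of the polygon
  \<open>x\<^sub>0, v\<^sub>0, x\<^sub>1, v\<^sub>1, \<dots>, x\<^sub>r\<close> into one arc (\<open>farey_group_ping_pong\<close>). Now \<open>t\<^sub>0\<close> fixes \<open>0\<close>, so its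
  \<open>T\<close>-conjugate is the transvection along \<open>- 1\<close>. It sends the vertices \<open>0\<close> and \<open>- 1\<close> to \<open>\<infinity>\<close> and
  \<open>- 1\<close>, which lie on no common arc; hence it is not in \<open>H\<close>.
\<close>

section \<open>Hurwitz moves\<close>

lemma (in group) mult_inv_mult:
  "x \<in> carrier G \<Longrightarrow> z \<in> carrier G \<Longrightarrow> x \<otimes> (inv x \<otimes> z) = z"
  by (simp flip: m_assoc)

text \<open>The factor that a move changes is conjugated by another factor, so it stays in every subgroup
  that contains all factors, and the same holds for the inverse move.\<close>

lemma strongly_equivalent_in_subgroup:
  assumes G: "group G" and K: "subgroup K G"
    and eq: "strongly_equivalent G ms ns" and ms: "set ms \<subseteq> K"
  shows "set ns \<subseteq> K"
proof -
  interpret group G by (rule G)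
  have conj_iff: "inv\<^bsub>G\<^esub> x \<otimes>\<^bsub>G\<^esub> y \<otimes>\<^bsub>G\<^esub> x \<in> K \<longleftrightarrow> y \<in> K" if "x \<in> K" "y \<in> carrier G" for x y
  proof
    have x: "x \<in> carrier G" using K that(1) by (rule subgroup.mem_carrier)
    assume y: "inv\<^bsub>G\<^esub> x \<otimes>\<^bsub>G\<^esub> y \<otimes>\<^bsub>G\<^esub> x \<in> K"
    have "x \<otimes>\<^bsub>G\<^esub> (inv\<^bsub>G\<^esub> x \<otimes>\<^bsub>G\<^esub> y \<otimes>\<^bsub>G\<^esub> x) \<otimes>\<^bsub>G\<^esub> inv\<^bsub>G\<^esub> x \<in> K"
      by (intro subgroup.m_closed[OF K] subgroup.m_inv_closed[OF K] that(1) y)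
    also have "x \<otimes>\<^bsub>G\<^esub> (inv\<^bsub>G\<^esub> x \<otimes>\<^bsub>G\<^esub> y \<otimes>\<^bsub>G\<^esub> x) \<otimes>\<^bsub>G\<^esub> inv\<^bsub>G\<^esub> x = y"
      using x that(2) by (simp add: m_assoc mult_inv_mult)
    finally show "y \<in> K" .
  next
    assume "y \<in> K"
    then show "inv\<^bsub>G\<^esub> x \<otimes>\<^bsub>G\<^esub> y \<otimes>\<^bsub>G\<^esub> x \<in> K"
      using K that(1) by (intro subgroup.m_closed subgroup.m_inv_closed)
  qed
  have move: "set ms \<subseteq> K \<longleftrightarrow> set ns \<subseteq> K" if "hurwitz_move G ms ns" for ms ns
    using that by cases (auto simp: bm_factorization_def conj_iff)
  from eq[unfolded strongly_equivalent_def] ms show ?thesis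
  proof (induction rule: equivclp_induct)
    case (step ns ns')
    then show ?case using move by blast
  qed
qed

lemma conjugate_elements_conjugate:
  assumes G: "group G" and ab: "conjugate_elements G a b" and h: "h \<in> carrier G"
  shows "conjugate_elements G a (inv\<^bsub>G\<^esub> h \<otimes>\<^bsub>G\<^esub> b \<otimes>\<^bsub>G\<^esub> h)"
proof -
  interpret group G by (rule G)
  from ab obtain g where g: "g \<in> carrier G" "a \<in> carrier G" "b \<in> carrier G"
    "b = inv\<^bsub>G\<^esub> g \<otimes>\<^bsub>G\<^esub> a \<otimes>\<^bsub>G\<^esub> g"
    by (auto simp: conjugate_elements_def)
  then have "inv\<^bsub>G\<^esub> h \<otimes>\<^bsub>G\<^esub> b \<otimes>\<^bsub>G\<^esub> h = inv\<^bsub>G\<^esub> (g \<otimes>\<^bsub>G\<^esub> h) \<otimes>\<^bsub>G\<^esub> a \<otimes>\<^bsub>G\<^esub> (g \<otimes>\<^bsub>G\<^esub> h)"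
    using h by (simp add: inv_mult_group m_assoc)
  moreover have "g \<otimes>\<^bsub>G\<^esub> h \<in> carrier G" "inv\<^bsub>G\<^esub> h \<otimes>\<^bsub>G\<^esub> b \<otimes>\<^bsub>G\<^esub> h \<in> carrier G"
    using g(1,3) h by simp_all
  ultimately show ?thesis using g(2) unfolding conjugate_elements_def by blast
qed

lemma monodromy_at_infinity_snoc:
  "monodromy_at_infinity G (ms @ [m]) = m \<otimes>\<^bsub>G\<^esub> monodromy_at_infinity G ms"
  by (simp add: monodromy_at_infinity_def)

lemma monodromy_at_infinity_closed:
  assumes "group G" and "set ms \<subseteq> carrier G"
  shows "monodromy_at_infinity G ms \<in> carrier G"
proof -
  interpret group G by fact
  show ?thesis using assms(2)
    by (induction ms rule: rev_induct)
       (auto simp: monodromy_at_infinity_snoc, simp add: monodromy_at_infinity_def)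
qed

lemma monodromy_at_infinity_conjugate:
  assumes "group G" and g: "g \<in> carrier G" and "set ms \<subseteq> carrier G"
  shows "monodromy_at_infinity G (map (\<lambda>m. inv\<^bsub>G\<^esub> g \<otimes>\<^bsub>G\<^esub> m \<otimes>\<^bsub>G\<^esub> g) ms)
    = inv\<^bsub>G\<^esub> g \<otimes>\<^bsub>G\<^esub> monodromy_at_infinity G ms \<otimes>\<^bsub>G\<^esub> g"
proof -
  interpret group G by fact
  show ?thesis using assms(3)
  proof (induction ms rule: rev_induct)
    case Nil
    then show ?case using g by (simp add: monodromy_at_infinity_def)
  next
    case (snoc m ms)
    then have c: "m \<in> carrier G" "monodromy_at_infinity G ms \<in> carrier G"
      by (auto intro: monodromy_at_infinity_closed is_group)
    show ?case using snoc c g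
      by (simp add: monodromy_at_infinity_snoc m_assoc mult_inv_mult)
  qed
qed

section \<open>Ping-pong in an abstract group\<close>

text \<open>The letters \<open>l\<close> and \<open>bar l\<close> stand for inverse elements. The predicate records the leftmost
  letter of a nonempty word in which no two inverse letters are adjacent.\<close>

inductive reduced_product ::
  "('a, 'b) monoid_scheme \<Rightarrow> 'l set \<Rightarrow> ('l \<Rightarrow> 'l) \<Rightarrow> ('l \<Rightarrow> 'a) \<Rightarrow> 'l \<Rightarrow> 'a \<Rightarrow> bool"
  for G (structure) and L and bar and t where
  letter: "l \<in> L \<Longrightarrow> reduced_product G L bar t l (t l)"
| extend: "reduced_product G L bar t l' h \<Longrightarrow> l \<in> L \<Longrightarrow> l' \<noteq> bar l \<Longrightarrow>
    reduced_product G L bar t l (t l \<otimes> h)"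

text \<open>The sets \<open>D l\<close> consist of group elements, not of points of a space on which the group acts. In
  the application an element belongs to \<open>D l\<close> if it moves given base points into the region of the
  letter \<open>l\<close>. Adding letters on the left one at a time shows that every reduced word belongs to the
  set of its leftmost letter, and every nontrivial element of the group is a reduced word.\<close>

lemma ping_pong:
  assumes G: "group G"
    and t: "\<And>l. l \<in> L \<Longrightarrow> t l \<in> carrier G"
    and bar: "\<And>l. l \<in> L \<Longrightarrow> bar l \<in> L" "\<And>l. l \<in> L \<Longrightarrow> bar (bar l) = l"
    and t_bar: "\<And>l. l \<in> L \<Longrightarrow> t (bar l) = inv\<^bsub>G\<^esub> t l"
    and base: "\<And>l. l \<in> L \<Longrightarrow> t l \<in> D l"
    and step: "\<And>l l' h. l \<in> L \<Longrightarrow> l' \<in> L \<Longrightarrow> l' \<noteq> bar l \<Longrightarrow> h \<in> carrier G \<Longrightarrow> h \<in> D l' \<Longrightarrow>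
      t l \<otimes>\<^bsub>G\<^esub> h \<in> D l"
    and h: "h \<in> generate G (t ` L)" and "h \<noteq> \<one>\<^bsub>G\<^esub>"
  shows "\<exists>l \<in> L. h \<in> D l"
proof -
  interpret group G by (rule G)
  let ?red = "reduced_product G L bar t"
  define R where "R = insert \<one>\<^bsub>G\<^esub> {h. \<exists>l. ?red l h}"
  have red: "l \<in> L \<and> h \<in> carrier G \<and> h \<in> D l" if "?red l h" for l h
    using that by induction (auto simp: t base step)
  have R_carrier: "R \<subseteq> carrier G" by (auto simp: R_def red)
  \<comment> \<open>If the new letter cancels the leftmost one, what remains is a shorter reduced word; so the set
    of reduced products is all of the generated subgroup.\<close>
  have letter_R: "t l \<otimes>\<^bsub>G\<^esub> h \<in> R" if l: "l \<in> L" and "h \<in> R" for l h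
  proof (cases "h = \<one>\<^bsub>G\<^esub>")
    case True
    then show ?thesis using l t reduced_product.letter by (fastforce simp: R_def)
  next
    case False
    with \<open>h \<in> R\<close> obtain l' where l': "?red l' h" by (auto simp: R_def)
    show ?thesis
    proof (cases "l' = bar l")
      case False
      then show ?thesis using reduced_product.extend[OF l' l] by (auto simp: R_def)
    next
      case True
      from l' show ?thesis
      proof cases
        case letter
        then show ?thesis using True t[OF l] t_bar[OF l] by (simp add: R_def)
      next
        case (extend l'' h')
        have "h' \<in> R" using extend(2) by (auto simp: R_def)
        moreover have "t l \<otimes>\<^bsub>G\<^esub> h = h'"
          unfolding extend(1) True t_bar[OF l] using red[OF extend(2)] t[OF l]
          by (intro mult_inv_mult) auto
        ultimately show ?thesis by simp
      qed
    qed
  qed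
  have t_carrier: "t ` L \<subseteq> carrier G" using t by auto
  have "\<forall>f \<in> R. h \<otimes>\<^bsub>G\<^esub> f \<in> R" using h
  proof induction
    case one
    then show ?case using R_carrier by auto
  next
    case (incl h)
    then show ?case using letter_R by auto
  next
    case (inv h)
    then obtain l where "l \<in> L" "h = t l" by auto
    then show ?case using letter_R[OF bar(1), of l] by (simp add: t_bar)
  next
    case (eng h1 h2)
    then have "h1 \<in> carrier G" "h2 \<in> carrier G"
      using generate_in_carrier[OF t_carrier] by blast+
    with eng.IH R_carrier show ?case by (simp add: m_assoc subset_iff)
  qed
  moreover have "\<one>\<^bsub>G\<^esub> \<in> R" by (simp add: R_def)
  moreover have "h \<in> carrier G" using generate_in_carrier[OF t_carrier h] .
  ultimately have "h \<in> R" using r_one by metis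
  then show ?thesis using \<open>h \<noteq> \<one>\<^bsub>G\<^esub>\<close> red by (auto simp: R_def)
qed

section \<open>The modular group\<close>

lemma matrix_vector_2_2:
  fixes A :: "int^2^2"
  shows "(A *v w)$1 = A$1$1 * w$1 + A$1$2 * w$2" "(A *v w)$2 = A$2$1 * w$1 + A$2$2 * w$2"
  by (simp_all add: matrix_vector_mult_def sum_2)

lemmas entries_2_2 = vec_eq_iff forall_2 matrix_matrix_mult_def sum_2 mat_def det_2

lemma PSL2Z_class_eq: "PSL2Z_class A = {A, - A}"
proof -
  have "(- mat 1) ** A = - A" by (simp add: entries_2_2)
  then show ?thesis by (auto simp: PSL2Z_class_def r_coset_def SL2Z_def)
qed

lemma PSL2Z_class_uminus: "PSL2Z_class (- A) = PSL2Z_class A"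
  by (auto simp: PSL2Z_class_eq)

lemma PSL2Z_class_mult:
  assumes "det A = 1" "det B = 1"
  shows "PSL2Z_class A \<otimes>\<^bsub>\<Gamma>\<^esub> PSL2Z_class B = PSL2Z_class (A ** B)"
  using normal.rcos_sum[OF normal_pm_one, of A B] assms
  by (simp add: PSL2Z_def FactGroup_def PSL2Z_class_def SL2Z_def)

lemma PSL2Z_one: "\<one>\<^bsub>\<Gamma>\<^esub> = PSL2Z_class (mat 1)"
  by (simp add: PSL2Z_class_eq PSL2Z_def FactGroup_def)

lemma PSL2Z_carrierE:
  assumes "h \<in> carrier \<Gamma>"
  obtains A where "det A = 1" "h = PSL2Z_class A"
  using assms by (auto simp: PSL2Z_class_def PSL2Z_def FactGroup_def RCOSETS_def SL2Z_def)

lemma PSL2Z_class_inv: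
  assumes "det A = 1" "det B = 1" "B ** A = mat 1"
  shows "inv\<^bsub>\<Gamma>\<^esub> PSL2Z_class A = PSL2Z_class B"
  using assms
  by (intro group.inv_equality[OF group_PSL2Z])
     (simp_all add: PSL2Z_class_mult PSL2Z_one PSL2Z_class_in_carrier)

definition shear :: "int \<Rightarrow> int^2^2" where
  "shear n = vector [vector [1, n], vector [0, 1]]"

lemma det_shear: "det (shear n) = 1"
  by (simp add: shear_def det_2)

lemma shear_mult: "shear m ** shear n = shear (m + n)"
  by (simp add: shear_def entries_2_2)

lemma XX_YY: "\<X> \<otimes>\<^bsub>\<Gamma>\<^esub> \<Y> = PSL2Z_class (shear 1)"
proof -
  have "(vector [vector [-1, 1], vector [-1, 0]] :: int^2^2) ** vector [vector [0, -1], vector [1, 0]] = shear 1"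
    by (simp add: shear_def entries_2_2)
  then show ?thesis unfolding XX_def YY_def by (subst PSL2Z_class_mult) (simp_all add: det_2)
qed

lemma shear_int_pow: "PSL2Z_class (shear 1) [^]\<^bsub>\<Gamma>\<^esub> n = PSL2Z_class (shear n)" for n :: int
proof -
  interpret group \<Gamma> by (rule group_PSL2Z)
  have nat: "PSL2Z_class (shear 1) [^]\<^bsub>\<Gamma>\<^esub> m = PSL2Z_class (shear (int m))" for m :: nat
  proof (induction m)
    case 0
    have "shear 0 = mat 1" by (simp add: shear_def entries_2_2)
    then show ?case by (simp add: PSL2Z_one)
  next
    case (Suc m)
    then show ?case by (simp add: PSL2Z_class_mult det_shear shear_mult add.commute)
  qed
  show ?thesis
  proof (cases n rule: int_cases2)
    case (nonneg m)
    then show ?thesis by (simp add: int_pow_int nat)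
  next
    case (nonpos m)
    have "shear n ** shear (int m) = mat 1"
      unfolding nonpos shear_mult by (simp add: shear_def entries_2_2)
    then show ?thesis
      by (simp add: nonpos int_pow_neg int_pow_int nat PSL2Z_class_in_carrier det_shear
          PSL2Z_class_inv)
  qed
qed

section \<open>Transvections and arcs\<close>

text \<open>A vector up to sign represents a point of the projective line, the vector \<open>(p, q)\<close> standing for
  \<open>p/q\<close>. For \<open>q, q' > 0\<close>, \<open>wedge (p, q) (p', q') > 0\<close> says that \<open>p/q > p'/q'\<close>.\<close>

definition wedge :: "int^2 \<Rightarrow> int^2 \<Rightarrow> int" where
  "wedge u w = u$1 * w$2 - u$2 * w$1"

text \<open>The matrix of \<open>w \<mapsto> w - c \<cdot> wedge w v \<cdot> v\<close>.\<close>

definition transvection :: "int \<Rightarrow> int^2 \<Rightarrow> int^2^2" where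
  "transvection c v = vector
     [vector [1 - c * v$1 * v$2, c * (v$1)\<^sup>2], vector [- c * (v$2)\<^sup>2, 1 + c * v$1 * v$2]]"

lemma transvection_apply: "transvection c v *v w = w - (c * wedge w v) *s v"
  by (simp add: vec_eq_iff forall_2 matrix_vector_2_2 transvection_def wedge_def
      algebra_simps power2_eq_square)

lemma det_transvection: "det (transvection c v) = 1"
  by (simp add: transvection_def det_2 algebra_simps power2_eq_square)

lemma transvection_inverse: "transvection (- c) v ** transvection c v = mat 1"
  by (simp add: transvection_def entries_2_2 algebra_simps power2_eq_square)

text \<open>In the basis \<open>(v, - u)\<close> of determinant \<open>1\<close> the transvection along \<open>v\<close> is the transvection along
  the first basis vector, which is \<open>shear 1\<close>.\<close>

lemma transvection_conjugate_XX_YY: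
  assumes uv: "wedge u v = 1"
  shows "conjugate_elements \<Gamma> (\<X> \<otimes>\<^bsub>\<Gamma>\<^esub> \<Y>) (PSL2Z_class (transvection 1 v))"
proof -
  interpret group \<Gamma> by (rule group_PSL2Z)
  \<comment> \<open>The inverse of the matrix with columns \<open>v\<close> and \<open>- u\<close>.\<close>
  define N :: "int^2^2" where "N = vector [vector [- u$2, u$1], vector [- v$2, v$1]]"
  have N: "det N = 1" using uv by (simp add: N_def det_2 wedge_def algebra_simps)
  have "N ** transvection 1 v = shear 1 ** N"
    using uv unfolding wedge_def
    by (simp add: N_def transvection_def shear_def entries_2_2 algebra_simps power2_eq_square)
  then have "PSL2Z_class N \<otimes>\<^bsub>\<Gamma>\<^esub> PSL2Z_class (transvection 1 v)
      = PSL2Z_class (shear 1) \<otimes>\<^bsub>\<Gamma>\<^esub> PSL2Z_class N"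
    by (simp add: PSL2Z_class_mult N det_transvection det_shear)
  then have "PSL2Z_class (transvection 1 v)
      = inv\<^bsub>\<Gamma>\<^esub> PSL2Z_class N \<otimes>\<^bsub>\<Gamma>\<^esub> PSL2Z_class (shear 1) \<otimes>\<^bsub>\<Gamma>\<^esub> PSL2Z_class N"
    by (simp add: m_assoc inv_solve_left PSL2Z_class_in_carrier N det_transvection det_shear)
  then show ?thesis
    by (auto simp: conjugate_elements_def XX_YY PSL2Z_class_in_carrier N det_transvection det_shear)
qed

text \<open>If \<open>wedge u v = 1\<close>, then \<open>w = a u + b v\<close> with \<open>a = wedge w v\<close> and \<open>b = wedge u w\<close>. So the closed arc
  from \<open>u\<close> to \<open>v\<close> is where the coordinates do not have opposite signs, and the complement of the
  open arc is where they do not have equal ones. Both conditions are unchanged if a vector is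
  replaced by its negative, as is needed for points of the projective line.\<close>

definition arc :: "int^2 \<Rightarrow> int^2 \<Rightarrow> (int^2) set" where
  "arc u v = {w. 0 \<le> wedge u w * wedge w v}"

definition outside_arc :: "int^2 \<Rightarrow> int^2 \<Rightarrow> (int^2) set" where
  "outside_arc u v = {w. wedge u w * wedge w v \<le> 0}"

text \<open>The transvection along \<open>v = u + x\<close> sends \<open>w = a u + b v\<close> to \<open>a (- x) + b v\<close>: the coordinates stay
  the same while \<open>u\<close> is exchanged for \<open>- x\<close>, so opposite signs become equal signs.\<close>

lemma transvection_outside_arc:
  assumes ux: "wedge u x = 1" and w: "w \<in> outside_arc u (u + x)"
  shows "transvection 1 (u + x) *v w \<in> arc (u + x) x"
proof -
  let ?t = "transvection 1 (u + x) *v w"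
  have "wedge (u + x) ?t = - wedge w (u + x)"
    by (simp add: transvection_apply wedge_def algebra_simps)
  moreover have "wedge ?t x = wedge w x - wedge w (u + x) * wedge u x"
    by (simp add: transvection_apply wedge_def algebra_simps)
  then have "wedge ?t x = wedge u w"
    by (simp add: ux) (simp add: wedge_def algebra_simps)
  ultimately show ?thesis using w by (simp add: arc_def outside_arc_def mult.commute)
qed

lemma inverse_transvection_outside_arc:
  assumes ux: "wedge u x = 1" and w: "w \<in> outside_arc (u + x) x"
  shows "transvection (- 1) (u + x) *v w \<in> arc u (u + x)"
proof -
  let ?t = "transvection (- 1) (u + x) *v w"
  have "wedge ?t (u + x) = wedge w (u + x)"
    by (simp add: transvection_apply wedge_def algebra_simps)
  moreover have "wedge u ?t = wedge u w + wedge w (u + x) * wedge u x"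
    by (simp add: transvection_apply wedge_def algebra_simps)
  then have "wedge u ?t = wedge w x"
    by (simp add: ux) (simp add: wedge_def algebra_simps)
  moreover have "wedge (u + x) w = - wedge w (u + x)"
    by (simp add: wedge_def algebra_simps)
  ultimately show ?thesis using w by (simp add: arc_def outside_arc_def mult.commute)
qed

text \<open>Two arcs that do not overlap are separated in the linear order given by \<open>wedge\<close>: both ends of the
  one precede both ends of the other. The product of two linear forms that are nonnegative (or
  nonpositive) at both \<open>u\<close> and \<open>v\<close> is nonnegative on the whole arc between them.\<close>

lemma arc_outside_arc:
  assumes uv: "wedge u v = 1" and w: "w \<in> arc u v"
    and side: "(0 \<le> wedge s u \<and> 0 \<le> wedge s v \<and> 0 \<le> wedge t u \<and> 0 \<le> wedge t v) \<or>
      (0 \<le> wedge u s \<and> 0 \<le> wedge v s \<and> 0 \<le> wedge u t \<and> 0 \<le> wedge v t)"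
  shows "w \<in> outside_arc s t"
proof -
  define a b where "a = wedge w v" and "b = wedge u w"
  have expand: "wedge z w = a * wedge z u + b * wedge z v" for z
  proof -
    have "wedge z w * wedge u v = a * wedge z u + b * wedge z v"
      by (simp add: a_def b_def wedge_def algebra_simps)
    then show ?thesis by (simp add: uv)
  qed
  have anti: "wedge p q = - wedge q p" for p q
    by (simp add: wedge_def)
  have "0 \<le> wedge s u * wedge t u" "0 \<le> wedge s u * wedge t v"
       "0 \<le> wedge s v * wedge t u" "0 \<le> wedge s v * wedge t v"
    using side by (auto simp: zero_le_mult_iff anti[of u s] anti[of v s] anti[of u t] anti[of v t])
  moreover have "0 \<le> a * b" using w by (simp add: arc_def a_def b_def mult.commute)
  ultimately have "0 \<le> (a * a) * (wedge s u * wedge t u) + (a * b) * (wedge s u * wedge t v)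
      + (a * b) * (wedge s v * wedge t u) + (b * b) * (wedge s v * wedge t v)"
    by (intro add_nonneg_nonneg mult_nonneg_nonneg[of "a * a"] mult_nonneg_nonneg[of "a * b"]
        mult_nonneg_nonneg[of "b * b"]) simp_all
  also have "\<dots> = wedge s w * wedge t w"
    unfolding expand by (simp add: algebra_simps)
  finally show ?thesis by (simp add: outside_arc_def anti[of w t])
qed

section \<open>Ping-pong for a Farey polygon\<close>

text \<open>A chain of Farey neighbours that turns through at most half a revolution in the plane of vectors,
  hence at most once around the projective line.\<close>

locale farey_chain =
  fixes r :: nat and x :: "nat \<Rightarrow> int^2"
  assumes adjacent: "i < r \<Longrightarrow> wedge (x i) (x (Suc i)) = 1"
    and ordered: "i \<le> j \<Longrightarrow> j \<le> r \<Longrightarrow> 0 \<le> wedge (x i) (x j)"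
begin

definition mediant :: "nat \<Rightarrow> int^2" where
  "mediant i = x i + x (Suc i)"

text \<open>Each mediant cuts the arc from \<open>x i\<close> to \<open>x (Suc i)\<close> into two; the Boolean is true for the second
  half. The side pairing of an arc is the transvection, or inverse transvection, that sends the
  complement of the other half into this arc.\<close>

fun arc_start arc_end :: "nat \<times> bool \<Rightarrow> int^2" where
  "arc_start (i, b) = (if b then mediant i else x i)"
| "arc_end (i, b) = (if b then x (Suc i) else mediant i)"

fun side_pairing :: "nat \<times> bool \<Rightarrow> int^2^2" where
  "side_pairing (i, b) = transvection (if b then 1 else - 1) (mediant i)"

fun opposite :: "nat \<times> bool \<Rightarrow> nat \<times> bool" where
  "opposite (i, b) = (i, \<not> b)"

definition sides :: "(nat \<times> bool) set" where
  "sides = {..<r} \<times> UNIV"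

lemma det_side_pairing: "det (side_pairing l) = 1"
  by (cases l) (simp add: det_transvection)

lemma wedge_add_left: "wedge (u + v) w = wedge u w + wedge v w"
  and wedge_add_right: "wedge w (u + v) = wedge w u + wedge w v"
  and wedge_self: "wedge u u = 0"
  by (simp_all add: wedge_def algebra_simps)

lemma wedge_arc_ends: "l \<in> sides \<Longrightarrow> wedge (arc_start l) (arc_end l) = 1"
  by (cases l) (auto simp: sides_def mediant_def adjacent wedge_add_left wedge_add_right wedge_self)

lemma arcs_non_overlapping:
  assumes "l \<in> sides" "l' \<in> sides" "l \<noteq> l'"
  shows "arc (arc_start l) (arc_end l) \<subseteq> outside_arc (arc_start l') (arc_end l')"
proof
  fix w assume w: "w \<in> arc (arc_start l) (arc_end l)"
  obtain i b j c where l: "l = (i, b)" "l' = (j, c)" by (cases l, cases l')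
  with assms have r: "i < r" "j < r" by (auto simp: sides_def)
  consider "i < j" | "j < i" | "i = j" "b \<noteq> c"
    using assms(3) l by (cases i j rule: linorder_cases) auto
  then show "w \<in> outside_arc (arc_start l') (arc_end l')"
  proof cases
    case 1
    with r have "0 \<le> wedge (x i) (x j)" "0 \<le> wedge (x i) (x (Suc j))"
      "0 \<le> wedge (x (Suc i)) (x j)" "0 \<le> wedge (x (Suc i)) (x (Suc j))"
      by (auto intro!: ordered)
    then show ?thesis
      by (intro arc_outside_arc[OF wedge_arc_ends[OF assms(1)] w] disjI2)
         (auto simp: l mediant_def wedge_add_left wedge_add_right)
  next
    case 2
    with r have "0 \<le> wedge (x j) (x i)" "0 \<le> wedge (x j) (x (Suc i))"
      "0 \<le> wedge (x (Suc j)) (x i)" "0 \<le> wedge (x (Suc j)) (x (Suc i))"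
      by (auto intro!: ordered)
    then show ?thesis
      by (intro arc_outside_arc[OF wedge_arc_ends[OF assms(1)] w] disjI1)
         (auto simp: l mediant_def wedge_add_left wedge_add_right)
  next
    case 3
    show ?thesis
      by (rule arc_outside_arc[OF wedge_arc_ends[OF assms(1)] w])
         (use 3 r adjacent[of i] in
           \<open>cases b; auto simp: l mediant_def wedge_add_left wedge_add_right wedge_self\<close>)
  qed
qed

lemma side_pairing_outside_arc:
  assumes "l \<in> sides" and "w \<in> outside_arc (arc_start (opposite l)) (arc_end (opposite l))"
  shows "side_pairing l *v w \<in> arc (arc_start l) (arc_end l)"
  using assms transvection_outside_arc inverse_transvection_outside_arc
  by (cases l) (auto simp: sides_def mediant_def adjacent split: if_splits)

definition farey_group :: "(int^2^2) set set" where
  "farey_group = generate \<Gamma> ((\<lambda>i. PSL2Z_class (transvection 1 (mediant i))) ` {..<r})"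

text \<open>The set \<open>V\<close> stands for vertices, that is, points \<open>x i\<close> and mediants: they lie off all open arcs.
  A letter moves them into its own arc, which lies off every other open arc, so the next letter of a reduced
  word can act in the same way.\<close>

lemma farey_group_ping_pong:
  assumes h: "PSL2Z_class A \<in> farey_group" "PSL2Z_class A \<noteq> \<one>\<^bsub>\<Gamma>\<^esub>"
    and V: "\<And>w l. w \<in> V \<Longrightarrow> l \<in> sides \<Longrightarrow> w \<in> outside_arc (arc_start l) (arc_end l)"
  shows "\<exists>l \<in> sides. (\<lambda>w. A *v w) ` V \<subseteq> arc (arc_start l) (arc_end l)"
proof -
  interpret group \<Gamma> by (rule group_PSL2Z)
  let ?t = "\<lambda>l. PSL2Z_class (side_pairing l)"
  define D where "D l = {h. \<forall>M \<in> h. \<forall>w \<in> V. M *v w \<in> arc (arc_start l) (arc_end l)}" for l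
  have neg: "(- M) *v w \<in> arc u v \<longleftrightarrow> M *v w \<in> arc u v"
    for M :: "int^2^2" and w u v
  proof -
    have "wedge u ((- M) *v w) = - wedge u (M *v w)" "wedge ((- M) *v w) v = - wedge (M *v w) v"
      by (simp_all add: wedge_def matrix_vector_2_2 algebra_simps)
    then show ?thesis by (simp add: arc_def)
  qed
  have D_iff: "PSL2Z_class M \<in> D l \<longleftrightarrow> (\<forall>w \<in> V. M *v w \<in> arc (arc_start l) (arc_end l))" for M l
    by (auto simp: D_def PSL2Z_class_eq neg)
  have opp: "opposite l \<in> sides" "opposite (opposite l) = l" if "l \<in> sides" for l
    using that by (cases l; simp add: sides_def)+
  have "\<exists>l \<in> sides. PSL2Z_class A \<in> D l"
  proof (rule ping_pong[where t = ?t and bar = opposite and G = \<Gamma>])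
    show "group \<Gamma>" by (rule group_PSL2Z)
    fix l assume l: "l \<in> sides"
    show "?t l \<in> carrier \<Gamma>" by (simp add: PSL2Z_class_in_carrier det_side_pairing)
    show "opposite l \<in> sides" "opposite (opposite l) = l" using opp[OF l] by auto
    have "side_pairing (opposite l) ** side_pairing l = mat 1"
      using transvection_inverse[of 1] transvection_inverse[of "-1"] by (cases l) auto
    then show "?t (opposite l) = inv\<^bsub>\<Gamma>\<^esub> ?t l"
      by (intro PSL2Z_class_inv[symmetric] det_side_pairing)
    show "?t l \<in> D l"
      using V opp[OF l] side_pairing_outside_arc[OF l] by (auto simp: D_iff)
    fix l' h assume l': "l' \<in> sides" "l' \<noteq> opposite l" and h: "h \<in> carrier \<Gamma>" "h \<in> D l'"
    obtain M where M: "det M = 1" "h = PSL2Z_class M" using h(1) by (rule PSL2Z_carrierE)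
    have "(side_pairing l ** M) *v w \<in> arc (arc_start l) (arc_end l)" if "w \<in> V" for w
      using that h(2) arcs_non_overlapping[OF l'(1) opp(1)[OF l] l'(2)]
      by (auto simp: M D_iff matrix_vector_mul_assoc[symmetric] intro!: side_pairing_outside_arc[OF l])
    then show "?t l \<otimes>\<^bsub>\<Gamma>\<^esub> h \<in> D l"
      by (simp add: M PSL2Z_class_mult det_side_pairing D_iff)
  next
    have "(\<lambda>i. PSL2Z_class (transvection 1 (mediant i))) ` {..<r} \<subseteq> ?t ` sides"
    proof
      fix h assume "h \<in> (\<lambda>i. PSL2Z_class (transvection 1 (mediant i))) ` {..<r}"
      then obtain i where "i < r" "h = ?t (i, True)" by auto
      then show "h \<in> ?t ` sides" unfolding sides_def by blast
    qed
    then show "PSL2Z_class A \<in> generate \<Gamma> (?t ` sides)"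
      using h(1) mono_generate unfolding farey_group_def by blast
    show "PSL2Z_class A \<noteq> \<one>\<^bsub>\<Gamma>\<^esub>" by (rule h)
  qed
  then show ?thesis by (auto simp: D_iff)
qed

end

section \<open>The fan of triangles at the cusp at infinity\<close>

text \<open>The points \<open>\<infinity>, - 1, - 2, \<dots>, - (r - 1)\<close> and again \<open>\<infinity>\<close>. The last vector is the negative of the first,
  since the chain runs exactly once around the projective line.\<close>

definition fan :: "nat \<Rightarrow> nat \<Rightarrow> int^2" where
  "fan r i = (if i = 0 then vector [1, 0] else if i < r then vector [- int i, 1] else vector [-1, 0])"

lemma farey_chain_fan: "2 \<le> r \<Longrightarrow> farey_chain r (fan r)"
  by unfold_locales (auto simp: fan_def wedge_def)

context
  fixes r :: nat
  assumes r: "2 \<le> r"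
begin

interpretation farey_chain r "fan r"
  by (rule farey_chain_fan[OF r])

lemma fan_mediant:
  "i < r \<Longrightarrow> mediant i = (if i = 0 then vector [0, 1]
     else if Suc i < r then vector [- (2 * int i + 1), 2] else vector [- int r, 1])"
  using r by (auto simp: mediant_def fan_def vec_eq_iff forall_2 of_nat_diff)

text \<open>The product of the first \<open>n\<close> transvections sends \<open>x 0\<close> to \<open>x n\<close>, up to sign; this is the first
  column \<open>(- n, 1)\<close>. Each transvection along \<open>- (2 n + 1) / 2\<close> changes the lower right entry by \<open>4\<close>,
  up to the common sign, and the determinant then fixes the remaining entry.\<close>

lemma fan_product:
  "0 < n \<Longrightarrow> n < r \<Longrightarrow>
    monodromy_at_infinity \<Gamma> (map (\<lambda>i. PSL2Z_class (transvection 1 (mediant i))) [0..<n])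
    = PSL2Z_class (vector [vector [- int n, int n * (4 * int n - 3) - 1], vector [1, 3 - 4 * int n]])"
  (is "_ \<Longrightarrow> _ \<Longrightarrow> ?P n = PSL2Z_class (?N n)")
proof (induction n)
  case (Suc n)
  let ?A = "transvection 1 (mediant n)"
  show ?case
  proof (cases "n = 0")
    case True
    have "?P 1 = PSL2Z_class (transvection 1 (mediant 0))"
      using group.is_monoid[OF group_PSL2Z]
      by (simp add: monodromy_at_infinity_def monoid.r_one PSL2Z_class_in_carrier det_transvection)
    also have "transvection 1 (mediant 0) = - ?N 1"
      using r by (simp add: transvection_def fan_mediant entries_2_2)
    finally show ?thesis using True by (simp add: PSL2Z_class_uminus)
  next
    case False
    have N: "det (?N n) = 1" by (simp add: det_2 algebra_simps)
    have A: "?A ** ?N n = - ?N (Suc n)"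
      using False Suc.prems
      by (simp add: transvection_def fan_mediant entries_2_2 algebra_simps power2_eq_square)
    have "?P (Suc n) = PSL2Z_class ?A \<otimes>\<^bsub>\<Gamma>\<^esub> ?P n"
      by (simp add: monodromy_at_infinity_snoc)
    also have "?P n = PSL2Z_class (?N n)" using False Suc by simp
    also have "PSL2Z_class ?A \<otimes>\<^bsub>\<Gamma>\<^esub> PSL2Z_class (?N n) = PSL2Z_class (- ?N (Suc n))"
      using PSL2Z_class_mult[OF det_transvection N, of 1 "mediant n"] A by simp
    finally show ?thesis by (simp only: PSL2Z_class_uminus)
  qed
qed simp

lemma fan_monodromy:
  "monodromy_at_infinity \<Gamma> (map (\<lambda>i. PSL2Z_class (transvection 1 (mediant i))) [0..<r])
    = PSL2Z_class (shear (6 - 5 * int r))"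
proof -
  obtain n where n: "r = Suc n" "0 < n" using r by (cases r) auto
  define N :: "int^2^2" where
    "N = vector [vector [- int n, int n * (4 * int n - 3) - 1], vector [1, 3 - 4 * int n]]"
  have mediant: "mediant n = vector [- int r, 1]" using n fan_mediant[of n] by simp
  have "det N = 1" by (simp add: N_def det_2 algebra_simps)
  moreover have "transvection 1 (mediant n) ** N = shear (6 - 5 * int r)"
    unfolding mediant using n
    by (simp add: N_def shear_def transvection_def entries_2_2 algebra_simps power2_eq_square)
  ultimately show ?thesis
    using n fan_product[of n]
    by (simp add: N_def[symmetric] monodromy_at_infinity_snoc PSL2Z_class_mult det_transvection)
qed

text \<open>The matrix fixes the point \<open>- 1\<close> and sends \<open>0\<close> to \<open>\<infinity>\<close>. No arc contains both \<open>- 1\<close> and \<open>\<infinity>\<close>: the two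
  arcs at \<open>\<infinity>\<close> run to \<open>0\<close> on one side and to \<open>- r\<close> on the other, and \<open>- r < - 1\<close>. The single base point
  \<open>0\<close> would not do, as \<open>\<infinity>\<close> is an end of both of these arcs, nor would \<open>- 1\<close>, which is fixed.\<close>

lemma shifted_transvection_notin_farey_group:
  "PSL2Z_class (transvection 1 (vector [-1, 1])) \<notin> farey_group"
proof
  let ?A = "transvection 1 (vector [-1, 1])"
  let ?V = "{vector [0, 1], vector [-1, 1]} :: (int^2) set"
  assume "PSL2Z_class ?A \<in> farey_group"
  moreover have "PSL2Z_class ?A \<noteq> \<one>\<^bsub>\<Gamma>\<^esub>"
    by (simp add: PSL2Z_one PSL2Z_class_eq doubleton_eq_iff transvection_def entries_2_2)
  moreover have "w \<in> outside_arc (arc_start l) (arc_end l)" if "w \<in> ?V" "l \<in> sides" for w l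
  proof -
    obtain i b where l: "l = (i, b)" by (cases l)
    then have "i < r" using that by (simp add: sides_def)
    then show ?thesis using that(1) r
      by (cases "i = 0"; cases b; cases "Suc i < r")
         (auto simp: l outside_arc_def wedge_def fan_mediant fan_def mult_le_0_iff)
  qed
  ultimately obtain l where l: "l \<in> sides" "(\<lambda>w. ?A *v w) ` ?V \<subseteq> arc (arc_start l) (arc_end l)"
    using farey_group_ping_pong[of ?A ?V] by blast
  obtain i b where ib: "l = (i, b)" by (cases l)
  then have "i < r" using l(1) by (simp add: sides_def)
  then show False using l(2) r
    by (cases "i = 0"; cases b; cases "Suc i < r")
       (auto simp: ib arc_def wedge_def fan_mediant fan_def transvection_apply zero_le_mult_iff)
qed

end

theorem corollary1p2p3:
  fixes k :: nat
  shows "\<exists>ms' ms''.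
    length ms' = k + 2 \<and> length ms'' = k + 2 \<and>
    simple_factorization ms' \<and> simple_factorization ms'' \<and>
    conjugate_factorizations \<Gamma> ms' ms'' \<and>
    monodromy_at_infinity \<Gamma> ms' = (\<X> \<otimes>\<^bsub>\<Gamma>\<^esub> \<Y>) [^]\<^bsub>\<Gamma>\<^esub> (- 5 * int k - 4) \<and>
    monodromy_at_infinity \<Gamma> ms'' = (\<X> \<otimes>\<^bsub>\<Gamma>\<^esub> \<Y>) [^]\<^bsub>\<Gamma>\<^esub> (- 5 * int k - 4) \<and>
    \<not> strongly_equivalent \<Gamma> ms' ms''"
proof -
  interpret group \<Gamma> by (rule group_PSL2Z)
  define r where "r = k + 2"
  then have r: "2 \<le> r" by simp
  interpret farey_chain r "fan r" by (rule farey_chain_fan[OF r])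
  let ?T = "PSL2Z_class (shear 1)"
  let ?conj = "\<lambda>m. inv\<^bsub>\<Gamma>\<^esub> ?T \<otimes>\<^bsub>\<Gamma>\<^esub> m \<otimes>\<^bsub>\<Gamma>\<^esub> ?T"
  let ?t = "\<lambda>v. PSL2Z_class (transvection 1 v)"
  define ms where "ms = map (\<lambda>i. ?t (mediant i)) [0..<r]"
  have T: "?T \<in> carrier \<Gamma>" by (simp add: PSL2Z_class_in_carrier det_shear)
  have t: "?t v \<in> carrier \<Gamma>" for v by (simp add: PSL2Z_class_in_carrier det_transvection)
  have ms: "set ms \<subseteq> carrier \<Gamma>" by (auto simp: ms_def t)
  have simple: "conjugate_elements \<Gamma> (\<X> \<otimes>\<^bsub>\<Gamma>\<^esub> \<Y>) m" if "m \<in> set ms" for m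
  proof -
    obtain i where i: "i < r" "m = ?t (mediant i)" using \<open>m \<in> set ms\<close> by (auto simp: ms_def)
    have "wedge (fan r i) (mediant i) = 1" using wedge_arc_ends[of "(i, False)"] i by (simp add: sides_def)
    then show ?thesis unfolding i by (rule transvection_conjugate_XX_YY)
  qed
  have power: "(\<X> \<otimes>\<^bsub>\<Gamma>\<^esub> \<Y>) [^]\<^bsub>\<Gamma>\<^esub> (- 5 * int k - 4) = PSL2Z_class (shear (6 - 5 * int r))"
  proof -
    have "- 5 * int k - 4 = 6 - 5 * int r" by (simp add: r_def)
    then show ?thesis by (simp only: XX_YY shear_int_pow)
  qed
  have monodromy: "monodromy_at_infinity \<Gamma> ms = PSL2Z_class (shear (6 - 5 * int r))"
    unfolding ms_def by (rule fan_monodromy[OF r])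
  have inv_T: "inv\<^bsub>\<Gamma>\<^esub> ?T = PSL2Z_class (shear (- 1))"
    by (rule PSL2Z_class_inv) (simp_all add: det_shear shear_mult, simp add: shear_def entries_2_2)
  have monodromy': "monodromy_at_infinity \<Gamma> (map ?conj ms) = monodromy_at_infinity \<Gamma> ms"
    unfolding monodromy_at_infinity_conjugate[OF group_PSL2Z T ms]
    by (simp add: monodromy inv_T PSL2Z_class_mult det_shear shear_mult)
  have "\<not> strongly_equivalent \<Gamma> ms (map ?conj ms)"
  proof
    assume eq: "strongly_equivalent \<Gamma> ms (map ?conj ms)"
    have "subgroup farey_group \<Gamma>"
      unfolding farey_group_def by (rule generate_is_subgroup) (auto simp: t)
    moreover have "set ms \<subseteq> farey_group"
      by (auto simp: ms_def farey_group_def intro: generate.incl)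
    ultimately have sub: "set (map ?conj ms) \<subseteq> farey_group"
      using strongly_equivalent_in_subgroup[OF group_PSL2Z _ eq] by simp
    have "?t (mediant 0) \<in> set ms" using r by (auto simp: ms_def)
    then have "?conj (?t (mediant 0)) \<in> set (map ?conj ms)" by (simp only: set_map) blast
    then have "?conj (?t (mediant 0)) \<in> farey_group" using sub by blast
    moreover have "?conj (?t (mediant 0)) = ?t (vector [-1, 1])"
    proof -
      have "shear (- 1) ** transvection 1 (mediant 0) ** shear 1 = transvection 1 (vector [-1, 1])"
        using r by (simp add: mediant_def fan_def shear_def transvection_def entries_2_2)
      then show ?thesis
        by (simp add: inv_T PSL2Z_class_mult det_shear det_transvection det_mul)
    qed
    ultimately show False using shifted_transvection_notin_farey_group[OF r] by simp
  qed
  moreover have "simple_factorization ms"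
    using ms simple by (simp add: simple_factorization_def bm_factorization_def)
  moreover have "simple_factorization (map ?conj ms)"
    using simple ms T conjugate_elements_conjugate[OF group_PSL2Z _ T]
    by (auto simp: simple_factorization_def bm_factorization_def)
  moreover have "conjugate_factorizations \<Gamma> ms (map ?conj ms)"
    using ms T by (auto simp: conjugate_factorizations_def bm_factorization_def)
  moreover have "length ms = k + 2" by (simp add: ms_def r_def)
  ultimately show ?thesis
    unfolding power
    by - (rule exI[of _ ms], rule exI[of _ "map ?conj ms"], simp add: monodromy monodromy')
qed

end
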